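(* Let $\lambda=(1,\dots,1)\in\mathbb{Z}^{n-1}$ and let $B=(1+\varepsilon)\cdot f^*_\lambda(s,t)$ for some $\varepsilon>0$. Then the cardinality of the minimal complete set $P^{NSP}_{min}(s,t)$ of UNSSPP$(G,\lambda)$ is intractable, i.e. it might be exponential in the number of vertices: there is a family of instances, consisting of directed graphs $G=(V,A)$ with arbitrarily large number $n=|V|$ of vertices, arc costs $c:A\to\mathbb{Z}_+$, vertices $s\ne t$ and $\varepsilon>0$, on which $|P^{NSP}_{min}(s,t)|$ grows exponentially in $n$.
   Context: $\mathbb{Z}_+$ denotes the nonnegative integers; directed graphs may have parallel arcs, and paths are distinguished by their arcs. $\mathcal{P}_{st}$ is the set of all simple directed $s$-$t$-paths in $G$; $l(P)\le n-1$ is the number of arcs of $P$. For a path $P$, $c_{(i)}(P)$ is the $i$-th largest arc cost on $P$ for $1\le i\le l(P)$, and $c_{(i)}(P)=0$ for $l(P)<i\le n-1$. $f_\lambda(P)=\sum_{i=1}^{n-1}\lambda_ic_{(i)}(P)$ and $f^*_\lambda(s,t)=\min_{P\in\mathcal{P}_{st}}f_\lambda(P)$. UNSSPP$(G,\lambda)$ asks to enumerate $P^{NSP}(s,t)=\{P\in\mathcal{P}_{st}: f_\lambda(P)\le B\}$. Two paths $P_1,P_2\in\mathcal{P}_{st}$ are equivalent iff $f_\lambda(P_1)=f_\lambda(P_2)$. A minimal complete set $P^{NSP}_{min}(s,t)\subseteq P^{NSP}(s,t)$ is a set such that every $P\in P^{NSP}(s,t)\setminus P^{NSP}_{min}(s,t)$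 is equivalent to exactly one $P'\in P^{NSP}_{min}(s,t)$; being minimal, it contains exactly one representative of each equivalence class of $P^{NSP}(s,t)$. *)

theory Defs
  imports Complex_Main "Graph_Theory.Arc_Walk"
begin

text \<open>
  Directed multigraphs are those of \<^theory>\<open>Graph_Theory.Digraph\<close>. A path is the list of its
  arcs, so two paths running through different parallel arcs are different.
\<close>

definition st_paths :: "('v, 'e) pre_digraph \<Rightarrow> 'v \<Rightarrow> 'v \<Rightarrow> 'e list set" where
  "st_paths G s t = {P. pre_digraph.apath G s P t}"

text \<open>The index \<open>i\<close> counts from 1; \<open>c\<^bsub>(i)\<^esub>(P) = 0\<close> once \<open>i\<close> exceeds the number of arcs.\<close>

definition ordered_cost :: "('e \<Rightarrow> nat) \<Rightarrow> 'e list \<Rightarrow> nat \<Rightarrow> nat" where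
  "ordered_cost c P i =
     (if 1 \<le> i \<and> i \<le> length P then rev (sort (map c P)) ! (i - 1) else 0)"

text \<open>
  A vector \<open>\<lambda>\<close> of length \<open>n - 1\<close>, where \<open>n\<close> is the number of vertices, is a function of which
  only the values at \<open>1, \<dots>, n - 1\<close> are used.
\<close>

definition ordered_path_cost ::
    "('v, 'e) pre_digraph \<Rightarrow> ('e \<Rightarrow> nat) \<Rightarrow> (nat \<Rightarrow> int) \<Rightarrow> 'e list \<Rightarrow> int" where
  "ordered_path_cost G c lam P =
     (\<Sum>i = 1..card (verts G) - 1. lam i * int (ordered_cost c P i))"

text \<open>The minimum is meaningful only if \<open>G\<close> is finite and has an \<open>s\<close>-\<open>t\<close>-path.\<close>

definition opt_path_cost ::
    "('v, 'e) pre_digraph \<Rightarrow> ('e \<Rightarrow> nat) \<Rightarrow> (nat \<Rightarrow> int) \<Rightarrow> 'v \<Rightarrow> 'v \<Rightarrow> int" where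
  "opt_path_cost G c lam s t = Min (ordered_path_cost G c lam ` st_paths G s t)"

definition near_shortest_paths ::
    "('v, 'e) pre_digraph \<Rightarrow> ('e \<Rightarrow> nat) \<Rightarrow> (nat \<Rightarrow> int) \<Rightarrow> 'v \<Rightarrow> 'v \<Rightarrow> real \<Rightarrow> 'e list set" where
  "near_shortest_paths G c lam s t B =
     {P \<in> st_paths G s t. real_of_int (ordered_path_cost G c lam P) \<le> B}"

definition equiv_paths ::
    "('v, 'e) pre_digraph \<Rightarrow> ('e \<Rightarrow> nat) \<Rightarrow> (nat \<Rightarrow> int) \<Rightarrow> 'e list \<Rightarrow> 'e list \<Rightarrow> bool" where
  "equiv_paths G c lam P Q \<longleftrightarrow> ordered_path_cost G c lam P = ordered_path_cost G c lam Q"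

definition complete_set ::
    "('v, 'e) pre_digraph \<Rightarrow> ('e \<Rightarrow> nat) \<Rightarrow> (nat \<Rightarrow> int) \<Rightarrow> 'v \<Rightarrow> 'v \<Rightarrow> real \<Rightarrow> 'e list set \<Rightarrow> bool"
  where
  "complete_set G c lam s t B M \<longleftrightarrow>
     M \<subseteq> near_shortest_paths G c lam s t B \<and>
     (\<forall>P \<in> near_shortest_paths G c lam s t B - M. \<exists>!P'. P' \<in> M \<and> equiv_paths G c lam P P')"

text \<open>Minimality is with respect to inclusion.\<close>

definition minimal_complete_set ::
    "('v, 'e) pre_digraph \<Rightarrow> ('e \<Rightarrow> nat) \<Rightarrow> (nat \<Rightarrow> int) \<Rightarrow> 'v \<Rightarrow> 'v \<Rightarrow> real \<Rightarrow> 'e list set \<Rightarrow> bool"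
  where
  "minimal_complete_set G c lam s t B M \<longleftrightarrow>
     complete_set G c lam s t B M \<and> (\<forall>M'. M' \<subset> M \<longrightarrow> \<not> complete_set G c lam s t B M')"

text \<open>
  Equivalently, a minimal complete set contains exactly one representative of each class.
\<close>

lemma minimal_complete_set_iff:
  "minimal_complete_set G c lam s t B M \<longleftrightarrow>
     M \<subseteq> near_shortest_paths G c lam s t B \<and>
     (\<forall>P \<in> near_shortest_paths G c lam s t B. \<exists>!P'. P' \<in> M \<and> equiv_paths G c lam P P')"
  (is "?L \<longleftrightarrow> ?R")
proof
  assume L: ?L
  let ?N = "near_shortest_paths G c lam s t B"
  have sub: "M \<subseteq> ?N"
    and ex: "\<And>P. P \<in> ?N - M \<Longrightarrow> \<exists>!P'. P' \<in> M \<and> equiv_paths G c lam P P'"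
    and minM: "\<And>M'. M' \<subset> M \<Longrightarrow> \<not> complete_set G c lam s t B M'"
    using L unfolding minimal_complete_set_def complete_set_def by blast+
  have inj: "P = Q" if P: "P \<in> M" and Q: "Q \<in> M" and PQ: "equiv_paths G c lam P Q" for P Q
  proof (rule ccontr)
    assume ne: "P \<noteq> Q"
    define M' where "M' = {R \<in> M. equiv_paths G c lam P R \<longrightarrow> R = P}"
    have "M' \<subset> M" using Q PQ ne unfolding M'_def by blast
    moreover have "complete_set G c lam s t B M'"
      unfolding complete_set_def
    proof (intro conjI ballI)
      show "M' \<subseteq> ?N" using sub unfolding M'_def by blast
      fix R assume R: "R \<in> ?N - M'"
      show "\<exists>!R'. R' \<in> M' \<and> equiv_paths G c lam R R'"
      proof (cases "equiv_paths G c lam P R")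
        case True
        then show ?thesis using P
          by (intro ex1I[of _ P]) (auto simp: M'_def equiv_paths_def)
      next
        case False
        then have "R \<in> ?N - M" using R unfolding M'_def by blast
        from ex[OF this] show ?thesis using False
          unfolding M'_def equiv_paths_def by (metis (mono_tags, lifting) mem_Collect_eq)
      qed
    qed
    ultimately show False using minM by blast
  qed
  have "\<exists>!P'. P' \<in> M \<and> equiv_paths G c lam P P'" if "P \<in> ?N" for P
  proof (cases "P \<in> M")
    case True
    then show ?thesis using inj by (intro ex1I[of _ P]) (auto simp: equiv_paths_def)
  next
    case False
    then show ?thesis using ex that by blast
  qed
  then show ?R using sub by blast
next
  assume R: ?R
  have "\<not> complete_set G c lam s t B M'" if M': "M' \<subset> M" for M'
  proof
    assume C: "complete_set G c lam s t B M'"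
    from M' obtain P where P: "P \<in> M" "P \<notin> M'" by blast
    with R have PN: "P \<in> near_shortest_paths G c lam s t B" by blast
    with C P obtain P' where "P' \<in> M'" "equiv_paths G c lam P P'"
      unfolding complete_set_def by blast
    moreover have "equiv_paths G c lam P P" by (simp add: equiv_paths_def)
    ultimately show False using R PN P M' by blast
  qed
  then show ?L using R unfolding minimal_complete_set_def complete_set_def by blast
qed

end

theory Submission
  imports Defs "HOL-Library.Multiset"
begin

text \<open>
  Take the vertices \<open>0, \<dots>, m\<close> and, from each \<open>i < m\<close> to \<open>i + 1\<close>, two parallel arcs of costs
  \<open>2\<^sup>i\<close> and \<open>2 \<cdot> 2\<^sup>i\<close>. Choosing one arc for every \<open>i\<close> amounts to choosing the binary digits of a
  number \<open>j < 2\<^sup>m\<close>, and the resulting path from \<open>0\<close> to \<open>m\<close> costs \<open>2\<^sup>m - 1 + j\<close>. So these paths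
  have \<open>2\<^sup>m\<close> different costs, none of which exceeds twice the least one, and with
  \<open>\<epsilon> = 1\<close> every cost class is represented in a minimal complete set.
\<close>

text \<open>Choosing one preimage for each attained cost gives the witness. This keeps a bound over
  all minimal complete sets from being vacuous.\<close>

lemma minimal_complete_set_exists: "\<exists>M. minimal_complete_set G c lam s t B M"
proof -
  let ?N = "near_shortest_paths G c lam s t B"
  let ?f = "ordered_path_cost G c lam"
  have "inv_into ?N ?f ` ?f ` ?N \<subseteq> ?N"
    by (auto intro: inv_into_into)
  moreover have "\<exists>!P'. P' \<in> inv_into ?N ?f ` ?f ` ?N \<and> equiv_paths G c lam P P'"
    if "P \<in> ?N" for P
    using that
    by (intro ex1I[of _ "inv_into ?N ?f (?f P)"]) (auto simp: equiv_paths_def f_inv_into_f)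
  ultimately show ?thesis
    by (intro exI[of _ "inv_into ?N ?f ` ?f ` ?N"]) (simp add: minimal_complete_set_iff)
qed

text \<open>Cost is injective on \<open>M\<close> and takes all its values there, so bounding
  \<open>card M\<close> reduces to counting attained costs.\<close>

lemma card_minimal_complete_set:
  assumes "minimal_complete_set G c lam s t B M"
  shows "card M = card (ordered_path_cost G c lam ` near_shortest_paths G c lam s t B)"
proof -
  let ?N = "near_shortest_paths G c lam s t B"
  let ?f = "ordered_path_cost G c lam"
  from assms have sub: "M \<subseteq> ?N"
    and rep: "\<And>P. P \<in> ?N \<Longrightarrow> \<exists>!P'. P' \<in> M \<and> ?f P = ?f P'"
    unfolding minimal_complete_set_iff equiv_paths_def by auto
  have inj: "inj_on ?f M"
    using sub rep by (intro inj_onI) blast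
  have "?f ` M = ?f ` ?N"
    using sub rep by blast
  then show ?thesis
    using card_image[OF inj] by simp
qed

text \<open>With unit weights the sorting is irrelevant. The length bound ensures that no arc lies
  beyond the last index; indices past the end of \<open>P\<close> contribute the default 0.\<close>

lemma ordered_path_cost_one:
  assumes "length P < card (verts G)"
  shows "ordered_path_cost G c (\<lambda>i. 1) P = int (\<Sum>a\<leftarrow>P. c a)"
proof -
  let ?xs = "rev (sort (map c P))"
  have "(\<Sum>i = 1..card (verts G) - 1. ordered_cost c P i) = (\<Sum>i = 1..length P. ?xs ! (i - 1))"
    using assms by (intro sum.mono_neutral_cong_right) (auto simp: ordered_cost_def)
  also have "\<dots> = (\<Sum>i<length P. ?xs ! i)"
    by (rule sum.reindex_bij_witness[of _ Suc "\<lambda>i. i - 1"]) auto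
  also have "\<dots> = sum_list ?xs"
    by (simp add: sum_list_sum_nth atLeast0LessThan)
  also have "\<dots> = (\<Sum>a\<leftarrow>P. c a)"
    by (metis mset_rev mset_sort sum_mset_sum_list)
  finally show ?thesis
    by (simp add: ordered_path_cost_def flip: of_nat_sum)
qed

text \<open>Arcs \<open>2 * i\<close> and \<open>2 * i + 1\<close> are the two parallel ones leaving
  \<open>i\<close>: the quotient by 2 is the tail, the remainder the chosen binary digit.\<close>

definition ladder :: "nat \<Rightarrow> (nat, nat) pre_digraph" where
  "ladder m = \<lparr>verts = {..m}, arcs = {..<2 * m}, tail = \<lambda>a. a div 2, head = \<lambda>a. Suc (a div 2)\<rparr>"

definition ladder_cost :: "nat \<Rightarrow> nat" where
  "ladder_cost a = 2 ^ (a div 2) * Suc (a mod 2)"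

lemma ladder_simps [simp]:
  "verts (ladder m) = {..m}" "arcs (ladder m) = {..<2 * m}"
  "tail (ladder m) a = a div 2" "head (ladder m) a = Suc (a div 2)"
  by (simp_all add: ladder_def)

lemma fin_digraph_ladder: "fin_digraph (ladder m)"
  by unfold_locales auto

text \<open>Each arc raises the vertex by one. This makes every walk simple and identifies its last
  vertex.\<close>

lemma ladder_cas_verts:
  "pre_digraph.cas (ladder m) u p v \<Longrightarrow> pre_digraph.awalk_verts (ladder m) u p = [u..<Suc v] \<and> u \<le> v"
proof (induction p arbitrary: u)
  case Nil
  then show ?case
    by (simp add: pre_digraph.cas.simps pre_digraph.awalk_verts.simps)
next
  case (Cons a p)
  from Cons.prems have "a div 2 = u" "pre_digraph.cas (ladder m) (Suc u) p v"
    by (auto simp: pre_digraph.cas.simps)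
  with Cons.IH[of "Suc u"] show ?case
    by (simp add: pre_digraph.awalk_verts.simps upt_conv_Cons)
qed

text \<open>An arc leaving \<open>u\<close> costs at least \<open>2 ^ u = 2 ^ Suc u - 2 ^ u\<close>,
  and these differences telescope along the walk.\<close>

lemma ladder_cas_cost:
  "pre_digraph.cas (ladder m) u p v \<Longrightarrow> 2 ^ v \<le> 2 ^ u + (\<Sum>a\<leftarrow>p. ladder_cost a)"
proof (induction p arbitrary: u)
  case Nil
  then show ?case
    by (simp add: pre_digraph.cas.simps)
next
  case (Cons a p)
  from Cons.prems have a: "a div 2 = u" and "pre_digraph.cas (ladder m) (Suc u) p v"
    by (auto simp: pre_digraph.cas.simps)
  then have "2 ^ v \<le> 2 ^ Suc u + (\<Sum>a\<leftarrow>p. ladder_cost a)"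
    using Cons.IH by blast
  moreover have "2 ^ u \<le> ladder_cost a"
    by (simp add: ladder_cost_def a)
  ultimately show ?case
    by simp
qed

text \<open>Induction on the number of digits: a prefix realises the lower digits
  \<open>j mod 2 ^ n\<close>, and one further arc adds the top digit. \<open>Suc\<close> on the left
  avoids truncated subtraction.\<close>

lemma ladder_path_of_cost:
  assumes "n \<le> m" "j < 2 ^ n"
  shows "\<exists>p. set p \<subseteq> {..<2 * n} \<and> pre_digraph.cas (ladder m) 0 p n \<and>
    Suc (\<Sum>a\<leftarrow>p. ladder_cost a) = 2 ^ n + j"
  using assms
proof (induction n arbitrary: j)
  case 0
  then show ?case
    by (intro exI[of _ "[]"]) (simp add: pre_digraph.cas.simps)
next
  case (Suc n)
  let ?b = "j div 2 ^ n"
  have b: "?b < 2"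
    using Suc.prems by (simp add: less_mult_imp_div_less)
  from Suc.IH[of "j mod 2 ^ n"] Suc.prems obtain p where
    p: "set p \<subseteq> {..<2 * n}" "pre_digraph.cas (ladder m) 0 p n"
      "Suc (\<Sum>a\<leftarrow>p. ladder_cost a) = 2 ^ n + j mod 2 ^ n"
    by auto
  \<comment> \<open>The prefix ends at \<open>n\<close>, which is the tail of the arc to be
    appended.\<close>
  have "pre_digraph.awalk_verts (ladder m) 0 p = [0..<Suc n]"
    using ladder_cas_verts p(2) by blast
  then have "pre_digraph.cas (ladder m) 0 (p @ [2 * n + ?b]) (Suc n)"
    using p(2) b by (simp add: pre_digraph.cas_append_iff pre_digraph.cas.simps)
  moreover have "ladder_cost (2 * n + ?b) = 2 ^ n + 2 ^ n * ?b"
    using b by (simp add: ladder_cost_def)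
  then have "Suc (\<Sum>a\<leftarrow>p @ [2 * n + ?b]. ladder_cost a) = 2 ^ Suc n + j"
    unfolding map_append sum_list_append list.map sum_list.Cons sum_list.Nil power_Suc
    using p(3) mult_div_mod_eq[of "2 ^ n" j] by linarith
  moreover have "set (p @ [2 * n + ?b]) \<subseteq> {..<2 * Suc n}"
    using p(1) b by auto
  ultimately show ?case
    by blast
qed

lemma ladder_st_path_iff:
  "p \<in> st_paths (ladder m) 0 m \<longleftrightarrow> set p \<subseteq> {..<2 * m} \<and> pre_digraph.cas (ladder m) 0 p m"
  using ladder_cas_verts[of m 0 p m]
  by (auto simp: st_paths_def pre_digraph.apath_def pre_digraph.awalk_def)

lemma finite_ladder_st_paths: "finite (st_paths (ladder m) s t)"
  unfolding st_paths_def by (rule fin_digraph.apaths_finite[OF fin_digraph_ladder])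

lemma ladder_path_cost:
  assumes "p \<in> st_paths (ladder m) s t"
  shows "ordered_path_cost (ladder m) ladder_cost (\<lambda>i. 1) p = int (\<Sum>a\<leftarrow>p. ladder_cost a)"
  using assms fin_digraph.length_apath_less[OF fin_digraph_ladder]
  by (intro ordered_path_cost_one) (auto simp: st_paths_def)

lemma opt_ladder_cost_ge:
  "2 ^ m \<le> opt_path_cost (ladder m) ladder_cost (\<lambda>i. 1) 0 m + 1"
proof -
  let ?f = "ordered_path_cost (ladder m) ladder_cost (\<lambda>i. 1)"
  \<comment> \<open>The path for \<open>j = 0\<close> exists, so the minimum is attained and the
    telescoped bound applies to a minimiser.\<close>
  have "st_paths (ladder m) 0 m \<noteq> {}"
    using ladder_path_of_cost[of m m 0] ladder_st_path_iff by fastforce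
  then have "Min (?f ` st_paths (ladder m) 0 m) \<in> ?f ` st_paths (ladder m) 0 m"
    using finite_ladder_st_paths by (intro Min_in) auto
  then obtain p where p: "p \<in> st_paths (ladder m) 0 m"
    and opt: "opt_path_cost (ladder m) ladder_cost (\<lambda>i. 1) 0 m = ?f p"
    unfolding opt_path_cost_def by auto
  have "2 ^ m \<le> Suc (\<Sum>a\<leftarrow>p. ladder_cost a)"
    using p ladder_cas_cost[of m 0 p m] by (simp add: ladder_st_path_iff)
  then have "int (2 ^ m) \<le> int (Suc (\<Sum>a\<leftarrow>p. ladder_cost a))"
    by (simp only: of_nat_le_iff)
  then show ?thesis
    by (simp add: opt ladder_path_cost[OF p])
qed

lemma card_ladder_minimal_complete_set:
  assumes "minimal_complete_set (ladder m) ladder_cost (\<lambda>i. 1) 0 m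
    (2 * real_of_int (opt_path_cost (ladder m) ladder_cost (\<lambda>i. 1) 0 m)) M"
  shows "2 ^ m \<le> card M"
proof -
  let ?opt = "opt_path_cost (ladder m) ladder_cost (\<lambda>i. 1) 0 m"
  let ?N = "near_shortest_paths (ladder m) ladder_cost (\<lambda>i. 1) 0 m (2 * real_of_int ?opt)"
  let ?f = "ordered_path_cost (ladder m) ladder_cost (\<lambda>i. 1)"
  have "(\<lambda>j. 2 ^ m + int j - 1) ` {..<2 ^ m} \<subseteq> ?f ` ?N"
  proof (rule image_subsetI)
    fix j :: nat
    assume "j \<in> {..<2 ^ m}"
    then have j: "j < 2 ^ m"
      by simp
    then obtain p where p: "p \<in> st_paths (ladder m) 0 m"
      and "Suc (\<Sum>a\<leftarrow>p. ladder_cost a) = 2 ^ m + j"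
      using ladder_path_of_cost[of m m j] by (auto simp: ladder_st_path_iff)
    then have "int (Suc (\<Sum>a\<leftarrow>p. ladder_cost a)) = 2 ^ m + int j"
      by simp
    then have cost: "?f p = 2 ^ m + int j - 1"
      by (simp add: ladder_path_cost[OF p])
    \<comment> \<open>By integrality \<open>j \<le> 2 ^ m - 1\<close>, so the cost is at most
      \<open>2 * (2 ^ m - 1) \<le> 2 * ?opt\<close>.\<close>
    have "int j < 2 ^ m"
      using j by simp
    then have "?f p \<le> 2 * ?opt"
      using opt_ladder_cost_ge[of m] cost by linarith
    then have "p \<in> ?N"
      using p by (simp add: near_shortest_paths_def)
    then show "2 ^ m + int j - 1 \<in> ?f ` ?N"
      using cost by (metis imageI)
  qed
  moreover have "finite (?f ` ?N)"
    unfolding near_shortest_paths_def by (simp add: finite_ladder_st_paths)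
  ultimately have "card ((\<lambda>j. 2 ^ m + int j - 1) ` {..<2 ^ m :: nat}) \<le> card (?f ` ?N)"
    by (intro card_mono)
  moreover have "inj_on (\<lambda>j. 2 ^ m + int j - 1) {..<2 ^ m :: nat}"
    by (auto intro: inj_onI)
  ultimately show ?thesis
    using card_minimal_complete_set[OF assms] by (simp add: card_image)
qed

theorem theorem4p5:
  shows "\<exists>(G :: nat \<Rightarrow> (nat, nat) pre_digraph) (c :: nat \<Rightarrow> nat \<Rightarrow> nat)
            (s :: nat \<Rightarrow> nat) (t :: nat \<Rightarrow> nat) (\<epsilon> :: nat \<Rightarrow> real).
     (\<forall>k. fin_digraph (G k) \<and> s k \<in> verts (G k) \<and> t k \<in> verts (G k) \<and> s k \<noteq> t k \<and> \<epsilon> k > 0) \<and>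
     filterlim (\<lambda>k. card (verts (G k))) at_top sequentially \<and>
     (\<exists>C :: real. C > 1 \<and>
       (\<forall>k. let lam = (\<lambda>i. 1);
                B = (1 + \<epsilon> k) * real_of_int (opt_path_cost (G k) (c k) lam (s k) (t k))
            in (\<exists>M. minimal_complete_set (G k) (c k) lam (s k) (t k) B M) \<and>
               (\<forall>M. minimal_complete_set (G k) (c k) lam (s k) (t k) B M \<longrightarrow>
                     real (card M) \<ge> C ^ card (verts (G k)))))"
proof -
  \<comment> \<open>With \<open>m = Suc k\<close> there are \<open>m + 1 \<le> 2 * m\<close>
    vertices, and \<open>sqrt 2 ^ (2 * m) = 2 ^ m\<close>; hence the base
    \<open>sqrt 2\<close>.\<close>
  have growth: "sqrt 2 ^ card (verts (ladder (Suc k))) \<le> real (card M)"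
    if "minimal_complete_set (ladder (Suc k)) ladder_cost (\<lambda>i. 1) 0 (Suc k)
      (2 * real_of_int (opt_path_cost (ladder (Suc k)) ladder_cost (\<lambda>i. 1) 0 (Suc k))) M" for k M
  proof -
    have "sqrt 2 ^ card (verts (ladder (Suc k))) \<le> sqrt 2 ^ (2 * Suc k)"
      by (intro power_increasing) auto
    also have "\<dots> = real (2 ^ Suc k)"
      by (simp add: power_mult)
    also have "\<dots> \<le> real (card M)"
      using card_ladder_minimal_complete_set[OF that] by (simp only: of_nat_le_iff)
    finally show ?thesis .
  qed
  have "filterlim (\<lambda>k. card (verts (ladder (Suc k)))) at_top sequentially"
    by (simp add: filterlim_sequentially_Suc[of "\<lambda>k. Suc k"] filterlim_Suc)
  \<comment> \<open>The shift to \<open>Suc k\<close> keeps source and target distinct;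
    \<open>\<epsilon> = 1\<close> turns the threshold into twice the optimum.\<close>
  then show ?thesis
    using growth minimal_complete_set_exists
    by (intro exI[of _ "\<lambda>k. ladder (Suc k)"] exI[of _ "\<lambda>k. ladder_cost"] exI[of _ "\<lambda>k. 0"]
        exI[of _ Suc] exI[of _ "\<lambda>k. 1"] conjI exI[of _ "sqrt 2"])
      (auto simp: fin_digraph_ladder Let_def)
qed

end
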